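(* Let $\mathcal{X}\subset\mathbb{R}^n$ be a compact convex set, let $f$ be a (possibly nonsmooth) real-valued convex function on $\mathcal{X}$, let $x^*\in\operatorname{argmin}_{x\in\mathcal{X}}f(x)$, and let $R>0$ be such that $\mathcal{X}\subset B(x^*,R)$. Fix $a\in[0,1]$ and an integer $t\geq 1$. Let $x_1,\dots,x_t\in\mathcal{X}$ and $g_s\in\partial f(x_s)$, $s=1,\dots,t$, be generated by the projected subgradient method (PSG) from a starting point $x_1\in\mathcal{X}$, with $g_1\neq 0$, using the step-sizes $$\eta_s=\frac{R}{G_s\, s^{a/2}},\qquad s=1,\dots,t,$$ where $$G_s=\max\{G_{s-1},\ \|g_s\|\,s^{\frac{1-a}{2}}\},\qquad G_0=-\infty .$$ Then $$f\left(\frac{\sum_{s=1}^t x_s}{t}\right)-f(x^* )\leq \frac{3R}{2\sqrt{t}}\cdot\max_{s=1,\dots,t}\|g_s\|.$$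
   Context: $\|\cdot\|$ is the Euclidean norm on $\mathbb{R}^n$ and $B(x^*,R)$ is the Euclidean ball of center $x^*$ and radius $R$. For $x\in\mathcal{X}$, $\partial f(x)$ denotes the subdifferential, i.e. the set of $g\in\mathbb{R}^n$ with $f(y)\geq f(x)+g^T(y-x)$ for all $y\in\mathcal{X}$; no bound on the norms of subgradients (no Lipschitz assumption on $f$) is imposed. The projected subgradient method (PSG) with step-sizes $\eta_s$ is the iteration: given $x_s$, choose any $g_s\in\partial f(x_s)$ (it is assumed that $\partial f(x_s)\neq\emptyset$ at the iterates, so that such a choice exists), and set $$y_{s+1}=x_s-\eta_s g_s,\qquad x_{s+1}=\operatorname{argmin}_{x\in\mathcal{X}}\|x-y_{s+1}\| .$$ The step-size $\eta_s$ may depend on $g_1,\dots,g_s$. *)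

theory Defs
  imports "HOL-Analysis.Analysis"
begin

definition subdifferential :: "(real ^ 'n) set \<Rightarrow> (real ^ 'n \<Rightarrow> real) \<Rightarrow> real ^ 'n \<Rightarrow> (real ^ 'n) set"
  where "subdifferential X f x = {g. \<forall>y\<in>X. f y \<ge> f x + g \<bullet> (y - x)}"

(* Only x 1, ..., x t and g 1, ..., g t are constrained; other values are irrelevant. *)
definition projected_subgradient ::
    "(real ^ 'n) set \<Rightarrow> (real ^ 'n \<Rightarrow> real) \<Rightarrow> (nat \<Rightarrow> real) \<Rightarrow> nat \<Rightarrow>
     (nat \<Rightarrow> real ^ 'n) \<Rightarrow> (nat \<Rightarrow> real ^ 'n) \<Rightarrow> bool"
  where "projected_subgradient X f \<eta> t x g \<longleftrightarrow>
    x 1 \<in> X \<and>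
    (\<forall>s\<in>{1..t}. g s \<in> subdifferential X f (x s)) \<and>
    (\<forall>s\<in>{1..<t}. let y = x s - \<eta> s *\<^sub>R g s
                   in is_arg_min (\<lambda>z. norm (z - y)) (\<lambda>z. z \<in> X) (x (s + 1)))"

primrec weighted_max :: "real \<Rightarrow> (nat \<Rightarrow> real ^ 'n) \<Rightarrow> nat \<Rightarrow> ereal"
  where
    "weighted_max a g 0 = -\<infinity>"
  | "weighted_max a g (Suc s) =
       max (weighted_max a g s) (ereal (norm (g (Suc s)) * real (Suc s) powr ((1 - a) / 2)))"

(* weighted_max is finite for s \<ge> 1, so real_of_ereal loses nothing at the indices that are used. *)
definition step_size :: "real \<Rightarrow> real \<Rightarrow> (nat \<Rightarrow> real ^ 'n) \<Rightarrow> nat \<Rightarrow> real"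
  where "step_size R a g s = R / (real_of_ereal (weighted_max a g s) * real s powr (a / 2))"

end

theory Submission
  imports Defs
begin

text \<open>
  Write \<open>d\<^sub>s\<close> for the squared distance of \<open>x s\<close> to the minimiser and \<open>M\<close> for the largest
  subgradient norm. Expanding the square of an unprojected step, and using that the projection does
  not move a point away from any point of \<open>X\<close>, bounds the gap \<open>f (x s) - f xstar\<close> by
  \<open>(d\<^sub>s - d\<^sub>s\<^sub>+\<^sub>1) / (2 * \<eta> s) + \<eta> s * (norm (g s))\<^sup>2 / 2\<close>. As the step sizes never increase and every \<open>d\<^sub>s\<close>
  is at most \<open>R\<^sup>2\<close>, summation by parts turns the first terms into the single term
  \<open>R\<^sup>2 / (2 * \<eta> t)\<close>; this is \<open>sum_inner_projected_subgradient\<close>.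

  The weight \<open>s powr ((1 - a) / 2)\<close> in the running maximum \<open>G\<^sub>s\<close> balances the two parts, in such a
  way that the exponent \<open>a\<close> disappears from both. From above, \<open>G\<^sub>t \<le> M * t powr ((1 - a) / 2)\<close>, so
  \<open>R\<^sup>2 / (2 * \<eta> t) \<le> R * M * sqrt t / 2\<close>. From below, \<open>G\<^sub>s \<ge> norm (g s) * s powr ((1 - a) / 2)\<close>, so
  \<open>\<eta> s * (norm (g s))\<^sup>2 \<le> R * M / sqrt s\<close>, and these terms sum to at most \<open>2 * R * M * sqrt t\<close>. The
  total is \<open>3 * R * M * sqrt t / 2\<close>. Jensen's inequality passes from the average of the
  gaps to the gap at the averaged iterate, with the division by \<open>t\<close>.
\<close>

lemma norm_projection_diff_le:
  fixes X :: "'a::euclidean_space set"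
  assumes "closed X" "convex X" "is_arg_min (\<lambda>z. norm (z - y)) (\<lambda>z. z \<in> X) p" "u \<in> X"
  shows "norm (p - u) \<le> norm (y - u)"
proof -
  have p: "p \<in> X" "\<forall>z\<in>X. dist y p \<le> dist y z"
    using assms(3) by (auto simp: is_arg_min_linorder dist_norm norm_minus_commute)
  have "closest_point X y = p"
    using closest_point_unique[OF assms(2,1) p] by simp
  then show ?thesis
    using closest_point_lipschitz[OF assms(2,1), of y u] closest_point_self[OF assms(4)] assms(4)
    by (auto simp: dist_norm)
qed

lemma projected_subgradient_iterate_in:
  assumes "projected_subgradient X f \<eta> t x g" "s \<in> {1..t}"
  shows "x s \<in> X"
proof (cases "s = 1")
  case True
  then show ?thesis using assms by (simp add: projected_subgradient_def)
next
  case False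
  then have "s - 1 \<in> {1..<t}" "s - 1 + 1 = s" using assms(2) by auto
  then show ?thesis using assms(1)
    by (metis (mono_tags, lifting) is_arg_min_def projected_subgradient_def)
qed

text \<open>
  Summation by parts is carried out as an induction whose invariant keeps the distance
  after the last gradient step as a slack term. Since that distance is measured before the
  projection, the bound also covers the last index \<open>t\<close>, for which there is no next iterate.
\<close>

lemma sum_inner_projected_subgradient:
  fixes X :: "(real ^ 'n) set"
  assumes X: "closed X" "convex X" "z \<in> X" "X \<subseteq> cball z R"
    and psg: "projected_subgradient X f \<eta> t x g"
    and pos: "\<And>s. s \<in> {1..t} \<Longrightarrow> \<eta> s > 0"
    and dec: "\<And>s. s \<in> {1..<t} \<Longrightarrow> \<eta> (Suc s) \<le> \<eta> s"
    and t: "t \<ge> 1"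
  shows "(\<Sum>s=1..t. g s \<bullet> (x s - z))
    \<le> R\<^sup>2 / (2 * \<eta> t) + (\<Sum>s=1..t. \<eta> s * (norm (g s))\<^sup>2) / 2"
proof -
  define d where "d = (\<lambda>s. (norm (x s - z))\<^sup>2)"
  define e where "e = (\<lambda>s. (norm (x s - \<eta> s *\<^sub>R g s - z))\<^sup>2)"
  define r where "r = (\<lambda>s. g s \<bullet> (x s - z) - \<eta> s * (norm (g s))\<^sup>2 / 2)"
  have r_eq: "r s = (d s - e s) / (2 * \<eta> s)" if "s \<in> {1..t}" for s
  proof -
    have "e s = d s - 2 * \<eta> s * (g s \<bullet> (x s - z)) + (\<eta> s)\<^sup>2 * (norm (g s))\<^sup>2"
      unfolding d_def e_def power2_norm_eq_inner
      by (simp add: inner_diff_left inner_diff_right inner_commute algebra_simps power2_eq_square)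
    then show ?thesis
      using pos[OF that] by (simp add: r_def field_simps power2_eq_square)
  qed
  have d_le: "d s \<le> R\<^sup>2" if "s \<in> {1..t}" for s
    using projected_subgradient_iterate_in[OF psg that] X(4)
    unfolding d_def by (intro power_mono) (auto simp: dist_norm norm_minus_commute)
  have d_e: "d (Suc s) \<le> e s" if "s \<in> {1..<t}" for s
  proof -
    have "is_arg_min (\<lambda>v. norm (v - (x s - \<eta> s *\<^sub>R g s))) (\<lambda>v. v \<in> X) (x (Suc s))"
      using psg that by (simp add: projected_subgradient_def Let_def)
    from norm_projection_diff_le[OF X(1,2) this X(3)]
    show ?thesis unfolding d_def e_def by (intro power_mono) auto
  qed
  have inv: "(\<Sum>s=1..k. r s) \<le> (R\<^sup>2 - e k) / (2 * \<eta> k)" if "1 \<le> k" "k \<le> t" for k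
    using that
  proof (induction k rule: dec_induct)
    case base
    have "r 1 \<le> (R\<^sup>2 - e 1) / (2 * \<eta> 1)"
      using r_eq[of 1] d_le[of 1] pos[of 1] t by (simp add: divide_right_mono)
    then show ?case by simp
  next
    case (step k)
    then have k: "k \<in> {1..<t}" "k \<in> {1..t}" "Suc k \<in> {1..t}" by auto
    \<comment> \<open>The shorter step size may replace the longer one because \<open>d (Suc k) \<le> R\<^sup>2\<close> makes the
      numerator nonnegative; \<open>d (Suc k)\<close> then cancels against the next summand.\<close>
    have "(R\<^sup>2 - e k) / (2 * \<eta> k) \<le> (R\<^sup>2 - d (Suc k)) / (2 * \<eta> k)"
      using d_e[OF k(1)] pos[OF k(2)] by (intro divide_right_mono) auto
    also have "\<dots> \<le> (R\<^sup>2 - d (Suc k)) / (2 * \<eta> (Suc k))"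
      using d_le[OF k(3)] pos[OF k(2)] pos[OF k(3)] dec[OF k(1)]
      by (intro divide_left_mono) auto
    finally have "(\<Sum>s=1..k. r s) \<le> (R\<^sup>2 - d (Suc k)) / (2 * \<eta> (Suc k))"
      using step by simp
    then have "(\<Sum>s=1..Suc k. r s)
        \<le> (R\<^sup>2 - d (Suc k)) / (2 * \<eta> (Suc k)) + (d (Suc k) - e (Suc k)) / (2 * \<eta> (Suc k))"
      using r_eq[OF k(3)] by simp
    then show ?case by (simp add: add_divide_distrib[symmetric])
  qed
  have "(\<Sum>s=1..t. r s) \<le> (R\<^sup>2 - e t) / (2 * \<eta> t)" using inv t by simp
  also have "\<dots> \<le> R\<^sup>2 / (2 * \<eta> t)"
    using pos[of t] t by (intro divide_right_mono) (auto simp: e_def)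
  finally show ?thesis
    by (simp add: r_def sum_subtractf sum_divide_distrib)
qed

lemma weighted_max_eq_Max:
  assumes "s \<ge> 1"
  shows "weighted_max a g s
    = ereal (Max ((\<lambda>i. norm (g i) * real i powr ((1 - a) / 2)) ` {1..s}))"
  using assms
proof (induction s rule: dec_induct)
  case (step s)
  have "{1..Suc s} = insert (Suc s) {1..s}" by auto
  then show ?case using step by (simp add: max.commute)
qed simp

text \<open>
  The induction step says \<open>1 / v \<le> 2 * (v - u)\<close> for the consecutive square roots \<open>u \<le> v\<close>. Because
  \<open>v\<^sup>2 = u\<^sup>2 + 1\<close>, this is \<open>(v - u)\<^sup>2 \<ge> 0\<close> in disguise.
\<close>

lemma sum_inverse_sqrt_le: "(\<Sum>s=1..t. 1 / sqrt (real s)) \<le> 2 * sqrt (real t)"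
proof (induction t)
  case (Suc t)
  define u v where "u = sqrt (real t)" and "v = sqrt (real (Suc t))"
  have uv: "0 \<le> u" "u \<le> v" "v > 0" "v * v = u * u + 1" by (auto simp: u_def v_def)
  have "0 \<le> (v - u)\<^sup>2" by simp
  then have "1 \<le> (2 * v - 2 * u) * v"
    using uv(4) by (simp add: algebra_simps power2_eq_square)
  then have "1 / v \<le> 2 * v - 2 * u" using uv(3) by (simp add: divide_le_eq)
  with Suc.IH show ?case by (simp add: u_def v_def)
qed simp

theorem theorem1:
  fixes X :: "(real ^ 'n) set" and f :: "real ^ 'n \<Rightarrow> real"
    and xstar :: "real ^ 'n" and x g :: "nat \<Rightarrow> real ^ 'n"
    and R a :: real and t :: nat
  assumes "compact X" and "convex X" and "convex_on X f"
    and "is_arg_min f (\<lambda>z. z \<in> X) xstar"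
    and "R > 0" and "X \<subseteq> cball xstar R"
    and "0 \<le> a" and "a \<le> 1" and "t \<ge> 1"
    and "g 1 \<noteq> 0"
    and "projected_subgradient X f (step_size R a g) t x g"
  shows "f ((\<Sum>s=1..t. x s) /\<^sub>R real t) - f xstar
    \<le> 3 * R / (2 * sqrt (real t)) * (MAX s\<in>{1..t}. norm (g s))"
proof -
  define \<eta> where "\<eta> = step_size R a g"
  define w where "w = (\<lambda>i. norm (g i) * real i powr ((1 - a) / 2))"
  define G where "G = (\<lambda>s. Max (w ` {1..s}))"
  define M where "M = (MAX s\<in>{1..t}. norm (g s))"
  have star: "xstar \<in> X" using assms(4) by (simp add: is_arg_min_def)
  have xX: "x s \<in> X" if "s \<in> {1..t}" for s
    using projected_subgradient_iterate_in[OF assms(11) that] .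
  have \<eta>: "\<eta> s = R / (G s * real s powr (a / 2))" if "s \<ge> 1" for s
    by (simp only: \<eta>_def step_size_def G_def w_def weighted_max_eq_Max[OF that] real_of_ereal.simps)
  have G_mono: "G s \<le> G s'" if "1 \<le> s" "s \<le> s'" for s s'
    unfolding G_def using that by (intro Max_mono) auto
  have w_le_G: "w s \<le> G s" if "s \<ge> 1" for s
    unfolding G_def using that by simp
  have G_pos: "G s > 0" if "s \<ge> 1" for s
  proof -
    have "0 < w 1" using assms(10) by (simp add: w_def)
    also have "\<dots> \<le> G s" using w_le_G[of 1] G_mono[of 1 s] that by simp
    finally show ?thesis .
  qed
  have g_le: "norm (g s) \<le> M" if "s \<in> {1..t}" for s
    unfolding M_def using that by (intro Max_ge) auto
  have M_nonneg: "0 \<le> M" using g_le[of 1] assms(9) by (auto intro: order_trans[OF norm_ge_zero])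
  have split_sqrt: "real s powr ((1 - a) / 2) * real s powr (a / 2) = sqrt (real s)" if "s \<ge> 1" for s
    using that by (simp add: powr_add[symmetric] powr_half_sqrt[symmetric] add_divide_distrib[symmetric])

  have pos: "\<eta> s > 0" if "s \<in> {1..t}" for s
    using that \<eta> G_pos[of s] assms(5) by simp
  have dec: "\<eta> (Suc s) \<le> \<eta> s" if "s \<in> {1..<t}" for s
  proof -
    have s: "s \<ge> 1" using that by simp
    have "G s * real s powr (a / 2) \<le> G (Suc s) * real (Suc s) powr (a / 2)"
      using s G_mono[of s "Suc s"] G_pos[of s] G_pos[of "Suc s"] assms(7)
      by (intro mult_mono powr_mono2) auto
    moreover have "0 < G s * real s powr (a / 2)" using s G_pos[of s] by simp
    ultimately show ?thesis
      using s assms(5) by (simp add: \<eta> frac_le)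
  qed
  \<comment> \<open>Every weight in the maximum is at most the last one, since \<open>(1 - a) / 2 \<ge> 0\<close>.\<close>
  have "G t \<le> M * real t powr ((1 - a) / 2)"
    unfolding G_def w_def using assms(8,9) g_le M_nonneg
    by (intro Max.boundedI) (auto intro!: mult_mono powr_mono2)
  then have "G t * real t powr (a / 2) \<le> M * sqrt (real t)"
    using split_sqrt[OF assms(9)] mult_right_mono[of "G t" _ "real t powr (a / 2)"]
    by (fastforce simp: mult.assoc)
  then have "R * (G t * real t powr (a / 2)) / 2 \<le> R * (M * sqrt (real t)) / 2"
    using assms(5) by (intro divide_right_mono mult_left_mono) auto
  then have first: "R\<^sup>2 / (2 * \<eta> t) \<le> R * M * sqrt (real t) / 2"
    using assms(5) by (simp add: \<eta>[OF assms(9)] power2_eq_square mult_ac)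
  have term_le: "\<eta> s * (norm (g s))\<^sup>2 \<le> R * M * (1 / sqrt (real s))" if "s \<in> {1..t}" for s
  proof -
    have s: "s \<ge> 1" using that by simp
    \<comment> \<open>One factor \<open>norm (g s)\<close> is absorbed by \<open>G s\<close>, the other one by \<open>M\<close>.\<close>
    have "norm (g s) * sqrt (real s) \<le> G s * real s powr (a / 2)"
      using mult_right_mono[OF w_le_G[OF s], of "real s powr (a / 2)"] split_sqrt[OF s]
      by (simp add: w_def mult.assoc)
    then have "norm (g s) * (norm (g s) * sqrt (real s)) \<le> M * (G s * real s powr (a / 2))"
      by (rule mult_mono[OF g_le[OF that] _ M_nonneg]) simp
    then have "R * (norm (g s) * (norm (g s) * sqrt (real s)))
        \<le> R * (M * (G s * real s powr (a / 2)))"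
      using assms(5) by simp
    then show ?thesis
      using s G_pos[OF s] by (simp add: \<eta> field_simps power2_eq_square)
  qed
  have "(\<Sum>s=1..t. \<eta> s * (norm (g s))\<^sup>2) \<le> R * M * (\<Sum>s=1..t. 1 / sqrt (real s))"
    unfolding sum_distrib_left by (intro sum_mono term_le)
  also have "\<dots> \<le> R * M * (2 * sqrt (real t))"
    using assms(5) M_nonneg by (intro mult_left_mono sum_inverse_sqrt_le) simp
  finally have second: "(\<Sum>s=1..t. \<eta> s * (norm (g s))\<^sup>2) / 2 \<le> R * M * sqrt (real t)"
    by simp

  have "(\<Sum>s=1..t. f (x s) - f xstar) \<le> (\<Sum>s=1..t. g s \<bullet> (x s - xstar))"
  proof (rule sum_mono)
    fix s assume "s \<in> {1..t}"
    then have "f xstar \<ge> f (x s) + g s \<bullet> (xstar - x s)"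
      using assms(11) star by (auto simp: projected_subgradient_def subdifferential_def)
    then show "f (x s) - f xstar \<le> g s \<bullet> (x s - xstar)"
      by (simp add: inner_diff_right)
  qed
  also have "\<dots> \<le> R\<^sup>2 / (2 * \<eta> t) + (\<Sum>s=1..t. \<eta> s * (norm (g s))\<^sup>2) / 2"
    using sum_inner_projected_subgradient[OF compact_imp_closed[OF assms(1)] assms(2) star
        assms(6) assms(11)[folded \<eta>_def] pos dec assms(9)] by simp
  also have "\<dots> \<le> 3 / 2 * R * M * sqrt (real t)"
    using first second by simp
  finally have gaps: "(\<Sum>s=1..t. f (x s) - f xstar) \<le> 3 / 2 * R * M * sqrt (real t)" .

  have "f (\<Sum>s=1..t. (1 / real t) *\<^sub>R x s) \<le> (\<Sum>s=1..t. (1 / real t) * f (x s))"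
    using assms(9) xX by (intro convex_on_sum[OF _ _ assms(3)]) auto
  then have "f ((\<Sum>s=1..t. x s) /\<^sub>R real t) \<le> (\<Sum>s=1..t. f (x s)) / real t"
    by (simp add: scaleR_sum_right sum_divide_distrib inverse_eq_divide)
  then have "f ((\<Sum>s=1..t. x s) /\<^sub>R real t) - f xstar \<le> (\<Sum>s=1..t. f (x s) - f xstar) / real t"
    using assms(9) by (simp add: sum_subtractf diff_divide_distrib)
  also have "\<dots> \<le> (3 / 2 * R * M * sqrt (real t)) / real t"
    using gaps by (intro divide_right_mono) auto
  also have "\<dots> = 3 * R / (2 * sqrt (real t)) * M"
    using assms(9) by (simp add: field_simps)
  finally show ?thesis by (simp add: M_def)
qed

end
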